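(* Let $n\ge 2$. For a subset $S\subset\{1,2,\dots,n\}^2$ let $$s=\Big\{x\in \mathrm{Mat}(n,\mathbb{C})\ \Big|\ x=\sum_{(k,m)\in S}x_{km}E_{km},\ x_{km}\in\mathbb{C}\Big\}$$ be the linear span of the matrix units $E_{km}$ with $(k,m)\in S$. The complete list of the maximal proper subalgebras of $\mathrm{Mat}(n,\mathbb{C})$ that are of this form (for some $S$) is $$s_{\mathbf{i}}(n)=\{x=(x_{km})_{k,m=1}^n\in \mathrm{Mat}(n,\mathbb{C})\mid x_{km}=0 \text{ for all } k\in\hat{\mathbf{i}},\ m\in\mathbf{i}\},$$ where $\mathbf{i}=\{i_1,i_2,\dots,i_k\}$ runs over all nonempty proper subsets of $\{1,2,\dots,n\}$ and $\hat{\mathbf{i}}=\{1,2,\dots,n\}\setminus\mathbf{i}$. The corresponding invariant subspace is $V_{\mathbf{i}}(n)=\langle e_{i_1},e_{i_2},\dots,e_{i_k}\rangle\subset\mathbb{C}^n$; that is, $xV_{\mathbf{i}}(n)\subseteq V_{\mathbf{i}}(n)$ for all $x\in s_{\mathbf{i}}(n)$.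
   Context: $\mathrm{Mat}(n,\mathbb{C})$ is the algebra of complex $n\times n$ matrices, acting on column vectors in $\mathbb{C}^n$; $E_{km}$ is the matrix unit with entry $1$ at position $(k,m)$ and $0$ elsewhere; $e_1,\dots,e_n$ is the standard basis of $\mathbb{C}^n$ and $\langle\cdot\rangle$ denotes linear span. A maximal proper subalgebra is a subalgebra different from $\mathrm{Mat}(n,\mathbb{C})$ that is not strictly contained in any other subalgebra different from $\mathrm{Mat}(n,\mathbb{C})$. *)

theory Defs
  imports "HOL-Analysis.Analysis"
begin

text \<open>
  \<open>Mat(n, C)\<close> is the type \<^typ>\<open>complex^'n^'n\<close>; the finite index type \<open>'n\<close> plays the role of
  \<open>{1, ..., n}\<close>, with \<open>n = CARD('n)\<close>.  The entry at position \<open>(k, m)\<close> is \<open>x $ k $ m\<close>.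
  HOL-Analysis only provides real scalar multiplication on this type, hence the following operation.
\<close>

definition matrix_scale :: "complex \<Rightarrow> complex^'n^'m \<Rightarrow> complex^'n^'m"
  where "matrix_scale c x = (\<chi> k m. c * x $ k $ m)"

interpretation cmat: vector_space "matrix_scale :: complex \<Rightarrow> complex^'n^'m \<Rightarrow> complex^'n^'m"
  by unfold_locales (simp_all add: matrix_scale_def vec_eq_iff algebra_simps)

definition matrix_unit :: "'n::finite \<Rightarrow> 'n \<Rightarrow> complex^'n^'n"
  where "matrix_unit k m = (\<chi> i j. if i = k \<and> j = m then 1 else 0)"

definition matrix_unit_span :: "('n::finite \<times> 'n) set \<Rightarrow> (complex^'n^'n) set"
  where "matrix_unit_span S =
    {x. \<exists>c. x = (\<Sum>(k, m)\<in>S. matrix_scale (c k m) (matrix_unit k m))}"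

lemma matrix_unit_span_eq_span:
  "matrix_unit_span S = cmat.span ((\<lambda>(k, m). matrix_unit k m) ` S)"
proof -
  have inj: "inj_on (\<lambda>(k, m). matrix_unit k m) S"
    by (auto simp: inj_on_def matrix_unit_def vec_eq_iff split: if_splits)
      (metis one_neq_zero)+
  show ?thesis
  proof (intro set_eqI iffI)
    fix x assume "x \<in> matrix_unit_span S"
    then show "x \<in> cmat.span ((\<lambda>(k, m). matrix_unit k m) ` S)"
      unfolding matrix_unit_span_def
      by (clarify, intro cmat.span_sum) (auto intro!: cmat.span_scale intro: cmat.span_base)
  next
    fix x assume "x \<in> cmat.span ((\<lambda>(k, m). matrix_unit k m) ` S)"
    then obtain u where "x = (\<Sum>v\<in>(\<lambda>(k, m). matrix_unit k m) ` S. matrix_scale (u v) v)"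
      by (auto simp: cmat.span_finite)
    then have "x = (\<Sum>(k, m)\<in>S. matrix_scale (u (matrix_unit k m)) (matrix_unit k m))"
      by (simp add: sum.reindex[OF inj, unfolded case_prod_unfold] case_prod_unfold)
    then show "x \<in> matrix_unit_span S"
      unfolding matrix_unit_span_def by (intro CollectI exI[of _ "\<lambda>k m. u (matrix_unit k m)"])
  qed
qed

text \<open>
  A subalgebra is not required to contain the identity matrix.
\<close>

definition matrix_subalgebra :: "(complex^'n^'n) set \<Rightarrow> bool"
  where "matrix_subalgebra A \<longleftrightarrow> cmat.subspace A \<and> (\<forall>x\<in>A. \<forall>y\<in>A. x ** y \<in> A)"

definition maximal_proper_subalgebra :: "(complex^'n^'n) set \<Rightarrow> bool"
  where "maximal_proper_subalgebra A \<longleftrightarrow>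
    matrix_subalgebra A \<and> A \<noteq> UNIV \<and> \<not> (\<exists>B. matrix_subalgebra B \<and> B \<noteq> UNIV \<and> A \<subset> B)"

definition s_alg :: "'n set \<Rightarrow> (complex^'n^'n) set"
  where "s_alg I = {x. \<forall>k\<in>- I. \<forall>m\<in>I. x $ k $ m = 0}"

definition V_space :: "'n::finite set \<Rightarrow> (complex^'n) set"
  where "V_space I = vec.span ((\<lambda>i. axis i 1) ` I)"

end

theory Submission
  imports Defs
begin

text \<open>
  The span of the matrix units in \<open>S\<close> is multiplicatively closed iff the relation \<open>S\<close> is transitive.
  If \<open>S\<close> is transitive and misses an off-diagonal pair \<open>(a, b)\<close>, the set of \<open>b\<close> and its
  \<open>S\<close>-predecessors gives a coordinate subspace that is invariant and proper; if \<open>S\<close> contains all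
  off-diagonal pairs, transitivity makes it everything.  Conversely, a subalgebra properly containing
  the stabiliser of a coordinate subspace contains one new matrix unit, and multiplying it on both
  sides by matrix units of the stabiliser yields all the missing ones.
\<close>

lemma matrix_unit_mult_left_nth:
  "(matrix_unit k m ** x) $ i $ j = (if i = k then x $ m $ j else 0)"
proof -
  have "(matrix_unit k m ** x) $ i $ j
      = (\<Sum>l\<in>UNIV. if l = m then (if i = k then x $ m $ j else 0) else 0)"
    unfolding matrix_matrix_mult_def matrix_unit_def vec_lambda_beta
    by (intro sum.cong) auto
  then show ?thesis
    by simp
qed

lemma matrix_unit_mult_right_nth:
  "(x ** matrix_unit k m) $ i $ j = (if j = m then x $ i $ k else 0)"
proof -
  have "(x ** matrix_unit k m) $ i $ j
      = (\<Sum>l\<in>UNIV. if l = k then (if j = m then x $ i $ k else 0) else 0)"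
    unfolding matrix_matrix_mult_def matrix_unit_def vec_lambda_beta
    by (intro sum.cong) auto
  then show ?thesis
    by simp
qed

lemma matrix_unit_mult:
  "matrix_unit k m ** matrix_unit m' j = (if m = m' then matrix_unit k j else 0)"
  by (simp add: vec_eq_iff matrix_unit_mult_left_nth) (simp add: matrix_unit_def)

text \<open>Isolates a single entry: a subalgebra that contains the two diagonal units also contains
  the multiple of \<open>matrix_unit k m\<close> read off from any of its elements
  \<open>x\<close>.\<close>

lemma matrix_unit_sandwich:
  "matrix_unit k k ** x ** matrix_unit m m = matrix_scale (x $ k $ m) (matrix_unit k m)"
  by (simp add: vec_eq_iff matrix_unit_mult_left_nth matrix_unit_mult_right_nth)
    (simp add: matrix_scale_def matrix_unit_def)

lemma matrix_unit_sum_nth: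
  "(\<Sum>(k, m)\<in>S. matrix_scale (c k m) (matrix_unit k m)) $ i $ j = (if (i, j) \<in> S then c i j else 0)"
proof -
  have "(\<Sum>(k, m)\<in>S. matrix_scale (c k m) (matrix_unit k m)) $ i $ j
      = (\<Sum>p\<in>S. if p = (i, j) then c i j else 0)"
    unfolding sum_component
    by (intro sum.cong) (auto simp: matrix_scale_def matrix_unit_def split: if_splits)
  then show ?thesis
    by simp
qed

text \<open>The coefficients of a combination of matrix units are its entries, so only the support
  of \<open>x\<close> matters. This turns questions about spans into questions about the relation
  \<open>S\<close>.\<close>

lemma mem_matrix_unit_span_iff:
  "x \<in> matrix_unit_span S \<longleftrightarrow> (\<forall>k m. x $ k $ m \<noteq> 0 \<longrightarrow> (k, m) \<in> S)"
proof
  assume "\<forall>k m. x $ k $ m \<noteq> 0 \<longrightarrow> (k, m) \<in> S"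
  then have "x = (\<Sum>(k, m)\<in>S. matrix_scale (x $ k $ m) (matrix_unit k m))"
    by (auto simp: vec_eq_iff matrix_unit_sum_nth simp del: sum_component)
  then show "x \<in> matrix_unit_span S"
    unfolding matrix_unit_span_def by (intro CollectI exI[of _ "\<lambda>k m. x $ k $ m"])
qed (auto simp: matrix_unit_span_def matrix_unit_sum_nth simp del: sum_component split: if_splits)

lemma matrix_unit_mem_span_iff: "matrix_unit k m \<in> matrix_unit_span S \<longleftrightarrow> (k, m) \<in> S"
  by (auto simp: mem_matrix_unit_span_iff matrix_unit_def)

lemma trans_of_matrix_subalgebra:
  assumes "matrix_subalgebra (matrix_unit_span S)"
  shows "trans S"
  using assms unfolding matrix_subalgebra_def
  by (metis transI matrix_unit_mem_span_iff matrix_unit_mult)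

lemma s_alg_eq_matrix_unit_span: "s_alg I = matrix_unit_span (- ((- I) \<times> I))"
  unfolding s_alg_def set_eq_iff mem_matrix_unit_span_iff by blast

lemma matrix_unit_mem_s_alg_iff: "matrix_unit k m \<in> s_alg I \<longleftrightarrow> k \<in> I \<or> m \<notin> I"
  by (auto simp: s_alg_eq_matrix_unit_span matrix_unit_mem_span_iff)

lemma matrix_subalgebra_s_alg: "matrix_subalgebra (s_alg I)"
  unfolding matrix_subalgebra_def
proof (intro conjI ballI)
  show "cmat.subspace (s_alg I)"
    unfolding s_alg_eq_matrix_unit_span matrix_unit_span_eq_span by (rule cmat.subspace_span)
next
  fix x y assume "x \<in> s_alg I" "y \<in> s_alg I"
  \<comment> \<open>If \<open>l\<close> lies in \<open>I\<close>, the factor from \<open>x\<close>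
    vanishes; otherwise the factor from \<open>y\<close> does.\<close>
  then have "x $ k $ l * y $ l $ m = 0" if "k \<notin> I" "m \<in> I" for k l m
    using that by (cases "l \<in> I") (auto simp: s_alg_def)
  then show "x ** y \<in> s_alg I"
    unfolding s_alg_def matrix_matrix_mult_def by (auto intro!: sum.neutral)
qed

lemma s_alg_neq_UNIV:
  assumes "I \<noteq> {}" "I \<noteq> UNIV"
  shows "s_alg I \<noteq> UNIV"
  using assms matrix_unit_mem_s_alg_iff by blast

lemma matrix_subalgebra_eq_UNIV:
  assumes "matrix_subalgebra B" and "\<And>k m. matrix_unit k m \<in> B"
  shows "B = UNIV"
proof -
  have "matrix_unit_span UNIV \<subseteq> B"
    unfolding matrix_unit_span_eq_span using assms
    by (intro cmat.span_minimal) (auto simp: matrix_subalgebra_def)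
  then show ?thesis
    by (auto simp: mem_matrix_unit_span_iff)
qed

lemma maximal_proper_subalgebra_s_alg:
  assumes "I \<noteq> {}" "I \<noteq> UNIV"
  shows "maximal_proper_subalgebra (s_alg I)"
  unfolding maximal_proper_subalgebra_def
proof (intro conjI notI)
  assume "\<exists>B. matrix_subalgebra B \<and> B \<noteq> UNIV \<and> s_alg I \<subset> B"
  then obtain B where B: "matrix_subalgebra B" "B \<noteq> UNIV" "s_alg I \<subseteq> B" and "\<not> B \<subseteq> s_alg I"
    by blast
  then obtain b k m where b: "b \<in> B" "k \<notin> I" "m \<in> I" "b $ k $ m \<noteq> 0"
    by (auto simp: s_alg_def)
  have mult: "x ** y \<in> B" if "x \<in> B" "y \<in> B" for x y
    using B(1) that by (simp add: matrix_subalgebra_def)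
  have units: "matrix_unit p q \<in> B" if "p \<in> I \<or> q \<notin> I" for p q
    using B(3) that matrix_unit_mem_s_alg_iff by blast
  \<comment> \<open>Diagonal units always belong to \<open>s_alg I\<close>, hence to
    \<open>B\<close>, so \<open>b\<close> may be sandwiched between them. The entry is nonzero and
    can then be divided out.\<close>
  have "matrix_scale (b $ k $ m) (matrix_unit k m) \<in> B"
    unfolding matrix_unit_sandwich[symmetric] using b by (intro mult units) auto
  then have "matrix_scale (inverse (b $ k $ m)) (matrix_scale (b $ k $ m) (matrix_unit k m)) \<in> B"
    using B(1) cmat.subspace_scale unfolding matrix_subalgebra_def by blast
  then have km: "matrix_unit k m \<in> B"
    using b(4) by simp
  have "matrix_unit p q \<in> B" for p q
  proof (cases "p \<in> I \<or> q \<notin> I")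
    case False
    \<comment> \<open>The outer factors lie in \<open>s_alg I\<close> because \<open>k\<close> is
      outside \<open>I\<close> and \<open>m\<close> is inside.\<close>
    then have "matrix_unit p k ** matrix_unit k m ** matrix_unit m q \<in> B"
      using b by (intro mult units km) auto
    then show ?thesis
      by (simp add: matrix_unit_mult)
  qed (rule units)
  then show False
    using matrix_subalgebra_eq_UNIV B by blast
qed (use assms matrix_subalgebra_s_alg s_alg_neq_UNIV in auto)

text \<open>If all off-diagonal pairs are present, going from \<open>a\<close> to another index
  \<open>c\<close> and back yields \<open>(a, a)\<close>. With a single index this breaks down: the
  empty relation is transitive and misses only a diagonal pair.\<close>

lemma trans_missing_off_diagonal:
  fixes S :: "('n::finite \<times> 'n) set"
  assumes "trans S" "S \<noteq> UNIV" and "CARD('n) \<ge> 2"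
  obtains a b where "a \<noteq> b" "(a, b) \<notin> S"
proof -
  obtain a b where ab: "(a, b) \<notin> S"
    using assms(2) by auto
  obtain c where "c \<noteq> a"
  proof (rule ccontr)
    assume "\<not> thesis"
    with that have "UNIV \<subseteq> {a}"
      by blast
    then have "CARD('n) \<le> card {a}"
      by (intro card_mono) auto
    moreover have "card {a} = 1"
      by simp
    ultimately show False
      using assms(3) by linarith
  qed
  show thesis
  proof (cases "a = b")
    case True
    then have "(a, c) \<notin> S \<or> (c, a) \<notin> S"
      using ab transD[OF assms(1), of a c a] by blast
    then show thesis
      using \<open>c \<noteq> a\<close> that[of a c] that[of c a] by blast
  qed (use ab that[of a b] in blast)
qed

lemma matrix_unit_span_le_s_alg:
  fixes S :: "('n::finite \<times> 'n) set"
  assumes "matrix_subalgebra (matrix_unit_span S)" "matrix_unit_span S \<noteq> UNIV"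
    and "CARD('n) \<ge> 2"
  obtains I where "I \<noteq> {}" "I \<noteq> UNIV" "matrix_unit_span S \<subseteq> s_alg I"
proof -
  have "trans S"
    using assms(1) by (rule trans_of_matrix_subalgebra)
  moreover have "S \<noteq> UNIV"
    using assms(2) by (auto simp: mem_matrix_unit_span_iff)
  ultimately obtain a b where ab: "a \<noteq> b" "(a, b) \<notin> S"
    using trans_missing_off_diagonal assms(3) by metis
  \<comment> \<open>The index \<open>b\<close> is added by hand since \<open>(b, b)\<close> may be
    missing from \<open>S\<close>; this keeps \<open>I\<close> nonempty. As \<open>a\<close> differs
    from \<open>b\<close> and is no predecessor of it, \<open>I\<close> is also proper.\<close>
  define I where "I = {k. k = b \<or> (k, b) \<in> S}"
  have "k \<in> I" if "(k, m) \<in> S" "m \<in> I" for k m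
    using that transD[OF \<open>trans S\<close>, of k m b] by (auto simp: I_def)
  then have "x $ k $ m = 0" if "x \<in> matrix_unit_span S" "k \<notin> I" "m \<in> I" for x k m
    using that by (auto simp: mem_matrix_unit_span_iff)
  then have "matrix_unit_span S \<subseteq> s_alg I"
    by (auto simp: s_alg_def)
  moreover have "b \<in> I" "a \<notin> I"
    using ab by (auto simp: I_def)
  ultimately show thesis
    using that by blast
qed

lemma V_space_nth_eq_0:
  assumes "v \<in> V_space I" "i \<notin> I"
  shows "v $ i = 0"
proof -
  have "V_space I \<subseteq> {v. v $ i = 0}"
    unfolding V_space_def using assms(2)
    by (intro vec.span_minimal) (auto simp: axis_def vec.subspace_def)
  with assms(1) show ?thesis
    by blast
qed

lemma mem_V_space_iff: "v \<in> V_space I \<longleftrightarrow> (\<forall>i. i \<notin> I \<longrightarrow> v $ i = 0)"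
proof
  assume zero: "\<forall>i. i \<notin> I \<longrightarrow> v $ i = 0"
  \<comment> \<open>These are the terms of the standard basis expansion of \<open>v\<close>; for
    \<open>i\<close> outside \<open>I\<close> the term is zero.\<close>
  have "v $ i *s axis i 1 \<in> V_space I" for i
    using zero unfolding V_space_def
    by (cases "i \<in> I") (auto intro: vec.span_scale vec.span_base vec.span_zero)
  then have "(\<Sum>i\<in>UNIV. v $ i *s axis i 1) \<in> V_space I"
    unfolding V_space_def by (rule vec.span_sum)
  then show "v \<in> V_space I"
    by (simp add: basis_expansion)
qed (auto intro: V_space_nth_eq_0)

lemma s_alg_V_space_invariant:
  assumes "x \<in> s_alg I" "v \<in> V_space I"
  shows "x *v v \<in> V_space I"
proof -
  \<comment> \<open>For \<open>m\<close> in \<open>I\<close> the matrix entry vanishes, for other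
    \<open>m\<close> the vector entry.\<close>
  have "x $ k $ m * v $ m = 0" if "k \<notin> I" for k m
    using assms that by (cases "m \<in> I") (auto simp: s_alg_def mem_V_space_iff)
  then show ?thesis
    unfolding mem_V_space_iff matrix_vector_mult_def by (auto intro!: sum.neutral)
qed

theorem theorem7:
  assumes "CARD('n::finite) \<ge> 2"
  shows "{A :: (complex^'n^'n) set. maximal_proper_subalgebra A \<and> (\<exists>S. A = matrix_unit_span S)}
           = {s_alg I | I. I \<noteq> {} \<and> I \<noteq> UNIV}
       \<and> (\<forall>I :: 'n set. I \<noteq> {} \<and> I \<noteq> UNIV \<longrightarrow>
           (\<forall>x\<in>s_alg I. (\<lambda>v. x *v v) ` V_space I \<subseteq> V_space I))"
proof (intro conjI subset_antisym subsetI)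
  fix A :: "(complex^'n^'n) set"
  assume "A \<in> {A. maximal_proper_subalgebra A \<and> (\<exists>S. A = matrix_unit_span S)}"
  then obtain S where A: "A = matrix_unit_span S" and max: "maximal_proper_subalgebra A"
    by blast
  then have "matrix_subalgebra A" "A \<noteq> UNIV"
    by (simp_all add: maximal_proper_subalgebra_def)
  then obtain I where I: "I \<noteq> {}" "I \<noteq> UNIV" "A \<subseteq> s_alg I"
    using matrix_unit_span_le_s_alg[OF _ _ assms] unfolding A by blast
  \<comment> \<open>A strict inclusion would contradict maximality, as \<open>s_alg I\<close> is
    itself a proper subalgebra; so the two coincide.\<close>
  then have "\<not> A \<subset> s_alg I"
    using max matrix_subalgebra_s_alg[of I] s_alg_neq_UNIV[of I]
    unfolding maximal_proper_subalgebra_def by blast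
  with I show "A \<in> {s_alg I | I. I \<noteq> {} \<and> I \<noteq> UNIV}"
    by blast
next
  fix A :: "(complex^'n^'n) set"
  assume "A \<in> {s_alg I | I. I \<noteq> {} \<and> I \<noteq> UNIV}"
  then obtain I where "A = s_alg I" "I \<noteq> {}" "I \<noteq> UNIV"
    by blast
  then show "A \<in> {A. maximal_proper_subalgebra A \<and> (\<exists>S. A = matrix_unit_span S)}"
    using maximal_proper_subalgebra_s_alg[of I] s_alg_eq_matrix_unit_span[of I] by blast
qed (auto intro: s_alg_V_space_invariant)

end
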